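(* Let $q$ be a power of $2$ and let $S^A,S^B\subseteq\mathbb{F}_q^n$ be $(1,h,\ell)$-sets, i.e. $|S^A\bigtriangleup S^B|\le h$ and $d_H(\mathbf{u},\mathbf{w})\le\ell$ for all $\mathbf{u},\mathbf{w}\in S^A\bigtriangleup S^B$. Let $(\mathbf{w}_1^A,\mathbf{w}_2^A)$ and $(\mathbf{w}_1^B,\mathbf{w}_2^B)$ be the outputs of the encoding procedure (given in the context) applied to $S^A$ and $S^B$ respectively, and let $\mathcal{F}$ be the output of the decoding procedure (given in the context) applied to $(\mathbf{w}_1^A,\mathbf{w}_2^A),(\mathbf{w}_1^B,\mathbf{w}_2^B)$. Then $\mathcal{F}=S^A\bigtriangleup S^B$.
   Context: **Notation.** $d_H$ is Hamming distance. An $[n,d]_q$ code is a linear code over $\mathbb{F}_q$ of length $n$ with minimum Hamming distance $d$. Let $r$ be a positive integer with $r<n$ and $n-r>r$. Let $\alpha$ be a primitive element of $\mathbb{F}_{q^r}$, with the convention (abuse of notation) $\alpha^{q^r}=\mathbf{0}$, so that every element of $\mathbb{F}_{q^r}$ is $\alpha^i$ for a unique $i\in\{1,\dots,q^r\}$; this $i$ is denoted $\log_\alpha$ of the element. $\mathbb{F}_q^r$ is identified with $\mathbb{F}_{q^r}$, and $\mathbb{F}_q^{n-r}$ with $\mathbb{F}_{q^{n-r}}$, by fixed $\mathbb{F}_q$-linear bijections. For an $r\times n$ matrix $H$ over $\mathbb{F}_q$ and $S\subseteq\mathbb{F}_q^n$, let $S_{H,i}=\{\mathbf{x}\in S: H\mathbf{x}=\alpha^i\}$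 for $1\le i\le q^r$, and $I_H(S)=(|S_{H,1}|,\dots,|S_{H,q^r}|)$. **Fixed data.** - $H_\ell\in\mathbb{F}_q^{r\times n}$ is a parity check matrix of an $[n,2\ell+1]_q$ code $\mathcal{C}_\ell$. $\mathcal{D}_\ell:\mathbb{F}_q^r\to\mathbb{F}_q^n$ is a syndrome decoder for it: $\mathcal{D}_\ell(H_\ell\mathbf{e})=\mathbf{e}$ whenever $\mathbf{e}$ has Hamming weight at most $\ell$. - $H_C\in\mathbb{F}_2^{u\times q^r}$ is a parity check matrix of a $[q^r,2h+1]_2$ code. $\mathcal{D}_C:\mathbb{F}_2^u\to\mathbb{F}_2^{q^r}$ is a syndrome decoder for it: $\mathcal{D}_C(H_C\mathbf{e})=\mathbf{e}$ whenever $\mathbf{e}$ has Hamming weight at most $h$. - $\bar H_\ell\in\mathbb{F}_q^{(n-r)\times n}$ is such that the $n\times n$ matrix $H_F=\begin{pmatrix}H_\ell\\ \bar H_\ell\end{pmatrix}$ has full rank. - $\mathbf{b}=(b_1,\dots,b_m)$ is a $B_h$ sequence over $\mathbb{F}_{q^{n-r}}$ with $m\ge q^r$: for every nonzero $\mathbf{a}\in\{0,1\}^m$ with at most $h$ nonzero entries, $\sum_i a_ib_i\ne 0$. **Encoding of a set $S$** (yielding $\mathbf{w}_1,\mathbf{w}_2$): 1. $\mathbf{z}=I_{H_\ell}(S)\bmod 2$. 2. $\mathbf{w}_1=H_C\cdot\mathbf{z}$ over $\mathbb{F}_2$. 3. $\mathbf{w}_2=\sum_{\mathbf{x}\in S}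 b_{\log_\alpha(H_\ell\mathbf{x})}\cdot(\bar H_\ell\mathbf{x})$, computed in $\mathbb{F}_{q^{n-r}}$. **Decoding** from $(\mathbf{w}_1^A,\mathbf{w}_2^A)$ and $(\mathbf{w}_1^B,\mathbf{w}_2^B)$: 1. $\hat{\mathbf{z}}=\mathcal{D}_C(\mathbf{w}_1^A+\mathbf{w}_1^B)$. 2. Let $\{k_1,\dots,k_v\}$ be the positions of the $1$s of $\hat{\mathbf{z}}$. If $\hat{\mathbf{z}}=\mathbf{0}$, output $\mathcal{F}=\emptyset$ and stop. 3. $\hat{\mathbf{e}}_i=\mathcal{D}_\ell(\alpha^{k_1}+\alpha^{k_i})$ for $2\le i\le v$. 4. $\mathbf{z}'=\mathbf{w}_2^A+\mathbf{w}_2^B+\sum_{i=2}^{v}b_{k_i}\cdot(\bar H_\ell\hat{\mathbf{e}}_i)$ in $\mathbb{F}_{q^{n-r}}$. 5. $\mathbf{s}_2=\mathbf{z}'/(b_{k_1}+\cdots+b_{k_v})$. 6. $\hat{\mathbf{x}}=H_F^{-1}\cdot(\alpha^{k_1},\mathbf{s}_2)^T$. 7. Output $\mathcal{F}=\{\hat{\mathbf{x}},\hat{\mathbf{x}}+\hat{\mathbf{e}}_2,\dots,\hat{\mathbf{x}}+\hat{\mathbf{e}}_v\}$. *)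

theory Defs
  imports
    "HOL-Library.Cardinality"
    "HOL-Library.Z2"
    "Jordan_Normal_Form.Matrix_Kernel"
    "Jordan_Normal_Form.DL_Rank"
begin

text \<open>
  Vectors and matrices over \<open>F\<^sub>q\<close> and \<open>F\<^sub>2\<close> are those of \<open>Jordan_Normal_Form\<close>, so \<open>F\<^sub>q\<^sup>n\<close> is
  \<open>carrier_vec n\<close>. The fields \<open>F\<^sub>q\<close>, \<open>F\<^bsub>q^r\<^esub>\<close> and \<open>F\<^bsub>q^(n-r)\<^esub>\<close> are finite field types, usually named
  \<open>'f\<close>, \<open>'k\<close> and \<open>'l\<close>; \<open>F\<^sub>2\<close> is the type \<open>bit\<close>.
  Positions are numbered \<open>1, \<dots>, q\<^sup>r\<close>, library vectors from 0, so the entry at position \<open>i\<close>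
  is \<open>v $ (i - 1)\<close>.
\<close>

definition hamming_dist :: "'a vec \<Rightarrow> 'a vec \<Rightarrow> nat" where
  "hamming_dist u v = card {i. i < dim_vec u \<and> u $ i \<noteq> v $ i}"

definition hamming_weight :: "'a::zero vec \<Rightarrow> nat" where
  "hamming_weight v = card {i. i < dim_vec v \<and> v $ i \<noteq> 0}"

definition min_distance :: "'a vec set \<Rightarrow> nat" where
  "min_distance C = Inf {hamming_dist u v | u v. u \<in> C \<and> v \<in> C \<and> u \<noteq> v}"

text \<open>A code has two distinct words, so that the infimum above is an attained minimum.\<close>

definition linear_code :: "nat \<Rightarrow> nat \<Rightarrow> 'a::field vec set \<Rightarrow> bool" where
  "linear_code n d C \<longleftrightarrow>
     VectorSpace.subspace class_ring C (module_vec TYPE('a) n) \<and>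
     (\<exists>u\<in>C. \<exists>v\<in>C. u \<noteq> v) \<and>
     min_distance C = d"

text \<open>The rows need not be linearly independent.\<close>

definition parity_check_matrix :: "nat \<Rightarrow> nat \<Rightarrow> 'a::field mat \<Rightarrow> 'a vec set \<Rightarrow> bool" where
  "parity_check_matrix r n H C \<longleftrightarrow> H \<in> carrier_mat r n \<and> C = mat_kernel H"

definition syndrome_decoder ::
  "nat \<Rightarrow> nat \<Rightarrow> nat \<Rightarrow> 'a::field mat \<Rightarrow> ('a vec \<Rightarrow> 'a vec) \<Rightarrow> bool" where
  "syndrome_decoder r n t H D \<longleftrightarrow>
     D \<in> carrier_vec r \<rightarrow> carrier_vec n \<and>
     (\<forall>e\<in>carrier_vec n. hamming_weight e \<le> t \<longrightarrow> D (H *\<^sub>v e) = e)"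

text \<open>
  An identification of \<open>F\<^sub>q\<^sup>d\<close> with an extension field of degree \<open>d\<close>: \<open>\<iota>\<close> embeds \<open>F\<^sub>q\<close> into the
  extension field, which makes the latter an \<open>F\<^sub>q\<close>-vector space, and \<open>\<phi>\<close> is an \<open>F\<^sub>q\<close>-linear bijection.
\<close>

definition linear_identification ::
  "nat \<Rightarrow> ('f::field \<Rightarrow> 'k::field) \<Rightarrow> ('f vec \<Rightarrow> 'k) \<Rightarrow> bool" where
  "linear_identification d \<iota> \<phi> \<longleftrightarrow>
     field_hom \<iota> \<and>
     bij_betw \<phi> (carrier_vec d) UNIV \<and>
     (\<forall>u\<in>carrier_vec d. \<forall>v\<in>carrier_vec d. \<phi> (u + v) = \<phi> u + \<phi> v) \<and>
     (\<forall>c. \<forall>v\<in>carrier_vec d. \<phi> (c \<cdot>\<^sub>v v) = \<iota> c * \<phi> v)"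

abbreviation vec_of :: "nat \<Rightarrow> ('f vec \<Rightarrow> 'k) \<Rightarrow> 'k \<Rightarrow> 'f vec" where
  "vec_of d \<phi> \<equiv> inv_into (carrier_vec d) \<phi>"

definition primitive_element :: "'k::field \<Rightarrow> bool" where
  "primitive_element \<alpha> \<longleftrightarrow> range (\<lambda>i::nat. \<alpha> ^ i) = UNIV - {0}"

text \<open>\<open>\<alpha>\<^sup>i\<close> for \<open>1 \<le> i \<le> q\<^sup>r\<close>, with the convention that the last power is \<open>0\<close>.\<close>

definition apow :: "'k::{field,finite} \<Rightarrow> nat \<Rightarrow> 'k" where
  "apow \<alpha> i = (if i = CARD('k) then 0 else \<alpha> ^ i)"

definition alog :: "'k::{field,finite} \<Rightarrow> 'k \<Rightarrow> nat" where
  "alog \<alpha> x = (THE i. i \<in> {1..CARD('k)} \<and> apow \<alpha> i = x)"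

definition B_sequence :: "nat \<Rightarrow> nat \<Rightarrow> (nat \<Rightarrow> 'l::field) \<Rightarrow> bool" where
  "B_sequence h m b \<longleftrightarrow>
     (\<forall>a :: nat \<Rightarrow> 'l.
        (\<forall>i\<in>{1..m}. a i \<in> {0, 1}) \<and>
        (\<exists>i\<in>{1..m}. a i \<noteq> 0) \<and>
        card {i\<in>{1..m}. a i \<noteq> 0} \<le> h
        \<longrightarrow> (\<Sum>i=1..m. a i * b i) \<noteq> 0)"

definition one_h_l_sets :: "nat \<Rightarrow> nat \<Rightarrow> 'f vec set \<Rightarrow> 'f vec set \<Rightarrow> bool" where
  "one_h_l_sets h l A B \<longleftrightarrow>
     card (sym_diff A B) \<le> h \<and>
     (\<forall>u\<in>sym_diff A B. \<forall>w\<in>sym_diff A B. hamming_dist u w \<le> l)"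

definition syndrome_class ::
  "'k::{field,finite} \<Rightarrow> ('f::{field,finite} vec \<Rightarrow> 'k) \<Rightarrow> 'f mat \<Rightarrow> 'f vec set \<Rightarrow> nat \<Rightarrow> 'f vec set"
  where "syndrome_class \<alpha> \<phi> H S i = {x\<in>S. \<phi> (H *\<^sub>v x) = apow \<alpha> i}"

definition syndrome_counts ::
  "'k::{field,finite} \<Rightarrow> ('f::{field,finite} vec \<Rightarrow> 'k) \<Rightarrow> 'f mat \<Rightarrow> 'f vec set \<Rightarrow> nat vec"
  where "syndrome_counts \<alpha> \<phi> H S = vec CARD('k) (\<lambda>j. card (syndrome_class \<alpha> \<phi> H S (j + 1)))"

definition encode1 ::
  "'k::{field,finite} \<Rightarrow> ('f::{field,finite} vec \<Rightarrow> 'k) \<Rightarrow> 'f mat \<Rightarrow> bit mat \<Rightarrow> 'f vec set \<Rightarrow> bit vec"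
  where "encode1 \<alpha> \<phi> H HC S =
     HC *\<^sub>v map_vec (\<lambda>c. of_nat (c mod 2)) (syndrome_counts \<alpha> \<phi> H S)"

definition encode2 ::
  "'k::{field,finite} \<Rightarrow> ('f::{field,finite} vec \<Rightarrow> 'k) \<Rightarrow> ('f vec \<Rightarrow> 'l::{field,finite}) \<Rightarrow>
   'f mat \<Rightarrow> 'f mat \<Rightarrow> (nat \<Rightarrow> 'l) \<Rightarrow> 'f vec set \<Rightarrow> 'l"
  where "encode2 \<alpha> \<phi> \<psi> H Hbar b S =
     (\<Sum>x\<in>S. b (alog \<alpha> (\<phi> (H *\<^sub>v x))) * \<psi> (Hbar *\<^sub>v x))"

text \<open>
  The argument \<open>enum\<close> lists the elements \<open>k\<^sub>1, \<dots>, k\<^sub>v\<close> of a finite set in some order, which the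
  procedure leaves open.
\<close>

definition decode ::
  "nat \<Rightarrow> nat \<Rightarrow> 'k::{field,finite} \<Rightarrow> ('f::{field,finite} vec \<Rightarrow> 'k) \<Rightarrow>
   ('f vec \<Rightarrow> 'l::{field,finite}) \<Rightarrow> 'f mat \<Rightarrow> 'f mat \<Rightarrow> (nat \<Rightarrow> 'l) \<Rightarrow>
   ('f vec \<Rightarrow> 'f vec) \<Rightarrow> (bit vec \<Rightarrow> bit vec) \<Rightarrow> (nat set \<Rightarrow> nat list) \<Rightarrow>
   bit vec \<times> 'l \<Rightarrow> bit vec \<times> 'l \<Rightarrow> 'f vec set"
  where "decode n r \<alpha> \<phi> \<psi> H Hbar b Dl DC enum wA wB =
    (let zhat = DC (fst wA + fst wB) in
     if zhat = 0\<^sub>v CARD('k) then {}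
     else
       let ks = enum {i\<in>{1..CARD('k)}. zhat $ (i - 1) = 1};
           k1 = hd ks;
           ehat = (\<lambda>k. Dl (vec_of r \<phi> (apow \<alpha> k1 + apow \<alpha> k)));
           z' = snd wA + snd wB + (\<Sum>k\<leftarrow>tl ks. b k * \<psi> (Hbar *\<^sub>v ehat k));
           s2 = z' / (\<Sum>k\<leftarrow>ks. b k);
           xhat = the (mat_inverse (H @\<^sub>r Hbar)) *\<^sub>v
                    (vec_of r \<phi> (apow \<alpha> k1) @\<^sub>v vec_of (n - r) \<psi> s2)
       in insert xhat ((\<lambda>k. xhat + ehat k) ` set (tl ks)))"

end

theory Submission
  imports Defs
begin

text \<open>
  Write \<open>D\<close> for the symmetric difference. Two distinct words of \<open>D\<close> differ by a word of weight at most
  \<open>l\<close>, which the syndrome decoder recovers, so the words of \<open>D\<close> have distinct syndromes. In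
  characteristic 2 the words common to both sets cancel from \<open>w\<^sub>1\<^sup>A + w\<^sub>1\<^sup>B\<close> and \<open>w\<^sub>2\<^sup>A + w\<^sub>2\<^sup>B\<close>; hence
  the former is the syndrome of the indicator vector of the set \<open>K\<close> of syndrome positions of \<open>D\<close>,
  whose weight is at most \<open>h\<close>. Once \<open>K\<close> and the differences from a fixed \<open>x\<^sub>1 \<in> D\<close> are known, adding
  the correction terms turns \<open>w\<^sub>2\<^sup>A + w\<^sub>2\<^sup>B\<close> into \<open>(\<Sum>k\<in>K. b k) * \<psi> (Hbar x\<^sub>1)\<close>, and the \<open>B\<^sub>h\<close> property
  allows the division.
\<close>

text \<open>Translation by 1 permutes the field, so summing all elements gives \<open>of_nat CARD('a) = 0\<close>.\<close>

lemma add_self_eq_0_if_card_power_of_2: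
  fixes x :: "'a::{field,finite}"
  assumes "CARD('a) = 2 ^ t"
  shows "x + x = 0"
proof -
  have "(\<Sum>y\<in>UNIV. y + 1 :: 'a) = (\<Sum>y\<in>UNIV. y)"
    by (rule sum.reindex_bij_witness[where i="\<lambda>y. y - 1" and j="\<lambda>y. y + 1"]) auto
  then have "(of_nat CARD('a) :: 'a) = 0"
    by (simp add: sum.distrib)
  then have "(2::'a) = 0"
    by (simp add: assms)
  then show ?thesis
    by (metis mult_2 mult_zero_left)
qed

section \<open>Powers of a primitive element\<close>

text \<open>Multiplication by \<open>x\<close> permutes the nonzero elements, so it leaves their
  nonzero product unchanged.\<close>

lemma power_card_minus_1_eq_1:
  fixes x :: "'a::{field,finite}"
  assumes "x \<noteq> 0"
  shows "x ^ (CARD('a) - 1) = 1"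
proof -
  have "(\<Prod>y\<in>UNIV-{0}. x * y) = (\<Prod>y\<in>UNIV-{0}. y)"
    using assms
    by (intro prod.reindex_bij_witness[where i="\<lambda>y. y / x" and j="\<lambda>y. x * y"]) auto
  then have "x ^ (CARD('a) - 1) * (\<Prod>y\<in>UNIV-{0}. y) = (\<Prod>y\<in>UNIV-{0}. y)"
    by (simp add: prod.distrib card_Diff_singleton)
  moreover have "(\<Prod>y\<in>UNIV-{0::'a}. y) \<noteq> 0"
    by simp
  ultimately show ?thesis by simp
qed

text \<open>Surjectivity suffices, because there are as many exponents as field elements.\<close>

lemma bij_betw_apow:
  fixes \<alpha> :: "'k::{field,finite}"
  assumes "primitive_element \<alpha>"
  shows "bij_betw (apow \<alpha>) {1..CARD('k)} UNIV"
proof -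
  let ?N = "CARD('k)"
  have range: "range (\<lambda>i::nat. \<alpha> ^ i) = UNIV - {0}"
    using assms by (simp add: primitive_element_def)
  then have "\<alpha> ^ 1 \<noteq> 0" by blast
  then have one: "\<alpha> ^ (?N - 1) = 1" by (intro power_card_minus_1_eq_1) simp
  have "card {0, 1::'k} \<le> ?N" by (intro card_mono) auto
  then have N: "?N \<ge> 2" by simp
  have "y \<in> apow \<alpha> ` {1..?N}" for y
  proof (cases "y = 0")
    case True
    then show ?thesis using N by (auto simp: apow_def intro!: image_eqI[of _ _ ?N])
  next
    case False
    then obtain i where i: "y = \<alpha> ^ i" using range by blast
    \<comment> \<open>Exponents matter only modulo \<open>?N - 1\<close>; positions start at 1, so
      residue 0 is represented by \<open>?N - 1\<close>.\<close>
    define j where "j = (if i mod (?N - 1) = 0 then ?N - 1 else i mod (?N - 1))"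
    have "y = \<alpha> ^ (i mod (?N - 1))"
    proof -
      have "y = \<alpha> ^ ((?N - 1) * (i div (?N - 1)) + i mod (?N - 1))"
        using i by simp
      then show ?thesis
        unfolding power_add power_mult one by simp
    qed
    then have "y = \<alpha> ^ j" using one by (simp add: j_def)
    moreover have "1 \<le> j" "j < ?N"
    proof -
      have "i mod (?N - 1) < ?N - 1" using N by (intro mod_less_divisor) simp
      then show "1 \<le> j" "j < ?N" by (auto simp: j_def)
    qed
    ultimately show ?thesis by (auto simp: apow_def intro!: image_eqI[of _ _ j])
  qed
  then have "apow \<alpha> ` {1..?N} = UNIV" by blast
  moreover from this have "inj_on (apow \<alpha>) {1..?N}"
    by (intro eq_card_imp_inj_on) auto
  ultimately show ?thesis by (simp add: bij_betw_def)
qed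

lemma
  fixes \<alpha> :: "'k::{field,finite}"
  assumes "primitive_element \<alpha>"
  shows alog_in_range: "alog \<alpha> x \<in> {1..CARD('k)}"
    and apow_alog: "apow \<alpha> (alog \<alpha> x) = x"
proof -
  have "\<exists>!i. i \<in> {1..CARD('k)} \<and> apow \<alpha> i = x"
    using bij_betw_apow[OF assms] unfolding bij_betw_iff_bijections
    by (metis UNIV_I)
  from theI'[OF this] show "alog \<alpha> x \<in> {1..CARD('k)}" "apow \<alpha> (alog \<alpha> x) = x"
    unfolding alog_def by auto
qed

lemma alog_apow:
  fixes \<alpha> :: "'k::{field,finite}"
  assumes "primitive_element \<alpha>" "i \<in> {1..CARD('k)}"
  shows "alog \<alpha> (apow \<alpha> i) = i"
  by (rule inj_onD[OF bij_betw_imp_inj_on[OF bij_betw_apow[OF assms(1)]]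
        apow_alog[OF assms(1)] alog_in_range[OF assms(1)] assms(2)])

section \<open>Characteristic 2, vectors and matrices\<close>

text \<open>Both sums contain the sum over \<open>A \<inter> B\<close>, and its two copies cancel.
  The constant function 1 gives parities of cardinalities; the weighted terms give the second
  component of the encoding.\<close>

lemma sum_add_sum_eq_sum_sym_diff:
  fixes f :: "'b \<Rightarrow> 'a::comm_ring_1"
  assumes "finite A" "finite B" and char2: "\<And>x::'a. x + x = 0"
  shows "sum f A + sum f B = sum f (sym_diff A B)"
proof -
  have "sum f A = sum f (A - B) + sum f (A \<inter> B)" "sum f B = sum f (B - A) + sum f (A \<inter> B)"
    using assms by (metis sum.Int_Diff add.commute Int_commute)+
  moreover have "sum f (sym_diff A B) = sum f (A - B) + sum f (B - A)"
    using assms by (intro sum.union_disjoint) auto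
  ultimately show ?thesis
    using char2[of "sum f (A \<inter> B)"] by (simp add: algebra_simps)
qed

text \<open>Serves to turn bounds on Hamming distances into bounds on weights of sums.\<close>

lemma add_eq_diff_vec:
  fixes u v :: "'a::ring vec"
  assumes "u \<in> carrier_vec n" "v \<in> carrier_vec n" "\<And>x::'a. x + x = 0"
  shows "u + v = u - v"
proof (intro eq_vecI)
  have "a - c = a + c" for a c :: 'a
    using assms(3)[of c] by (metis add.inverse_unique diff_conv_add_uminus)
  then show "(u + v) $ i = (u - v) $ i" if "i < dim_vec (u - v)" for i
    using that assms(1,2) by simp
qed (use assms in simp)

lemma hamming_weight_diff:
  fixes u v :: "'a::ring vec"
  assumes "u \<in> carrier_vec n" "v \<in> carrier_vec n"
  shows "hamming_weight (u - v) = hamming_dist u v"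
proof -
  have "{i. i < dim_vec (u - v) \<and> (u - v) $ i \<noteq> 0} = {i. i < dim_vec u \<and> u $ i \<noteq> v $ i}"
    using assms by (intro Collect_cong) auto
  then show ?thesis
    by (simp only: hamming_weight_def hamming_dist_def)
qed

text \<open>Vectors are images of lists of fixed length over a finite type. Hence the encoded sets
  are finite, and \<open>card\<close> and \<open>sum\<close> do not fall back to their default 0 for
  infinite sets.\<close>

lemma finite_carrier_vec: "finite (carrier_vec n :: 'a::finite vec set)"
proof -
  have "v = vec_of_list (list_of_vec v) \<and> set (list_of_vec v) \<subseteq> UNIV \<and> length (list_of_vec v) = n"
    if "v \<in> carrier_vec n" for v :: "'a vec"
    using that by (auto simp: vec_list)
  then have "carrier_vec n \<subseteq> vec_of_list ` {xs :: 'a list. set xs \<subseteq> UNIV \<and> length xs = n}"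
    by blast
  then show ?thesis
    using finite_imageI[OF finite_lists_length_eq[OF finite]] by (rule finite_subset)
qed

text \<open>Full rank makes the determinant nonzero, so \<open>mat_inverse\<close> returns
  \<open>Some\<close> and \<open>the\<close> selects a genuine inverse.\<close>

lemma mat_inverse_mult_vec:
  fixes A :: "'a::field mat"
  assumes A: "A \<in> carrier_mat n n" and rank: "vec_space.rank n A = n" and x: "x \<in> carrier_vec n"
  shows "the (mat_inverse A) *\<^sub>v (A *\<^sub>v x) = x"
proof -
  have "det A \<noteq> 0"
    using vec_space.det_rank_iff[OF A] rank by blast
  then have "A \<in> Units (ring_mat TYPE('a) n ())"
    by (rule det_non_zero_imp_unit[OF A])
  then obtain B where "mat_inverse A = Some B"
    using mat_inverse(1)[OF A, where b="()"] by (cases "mat_inverse A") auto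
  with mat_inverse(2)[OF A this] show ?thesis
    using A x assoc_mult_mat_vec[of B n n A n x] \<open>mat_inverse A = Some B\<close> by simp
qed

section \<open>Sums of a B-sequence and sums of encodings\<close>

text \<open>The indicator function of \<open>K\<close> is an admissible coefficient sequence. This
  makes the divisor in the decoder nonzero.\<close>

lemma B_sequence_sum_nonzero:
  fixes b :: "nat \<Rightarrow> 'l::field"
  assumes "B_sequence h m b" "K \<subseteq> {1..m}" "K \<noteq> {}" "card K \<le> h"
  shows "(\<Sum>k\<in>K. b k) \<noteq> 0"
proof -
  define a where "a i = (if i \<in> K then 1 else 0 :: 'l)" for i
  have "{i\<in>{1..m}. a i \<noteq> 0} = K" using assms(2) by (auto simp: a_def)
  then have "card {i\<in>{1..m}. a i \<noteq> 0} \<le> h" using assms(4) by simp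
  moreover have "\<forall>i\<in>{1..m}. a i \<in> {0, 1}" by (simp add: a_def)
  moreover have "\<exists>i\<in>{1..m}. a i \<noteq> 0" using assms(2,3) by (auto simp: a_def)
  ultimately have "(\<Sum>i=1..m. a i * b i) \<noteq> 0"
    using assms(1) unfolding B_sequence_def by blast
  moreover have "(\<Sum>i=1..m. a i * b i) = (\<Sum>k\<in>K. b k)"
    using assms(2) by (intro sum.mono_neutral_cong_right) (auto simp: a_def)
  ultimately show ?thesis by simp
qed

text \<open>The cast to \<open>bit\<close> absorbs the reduction mod 2, syndrome classes commute
  with symmetric differences, and parities add under them; the rest is linearity of
  \<open>HC\<close>.\<close>

lemma encode1_add:
  fixes SA SB :: "'f::{field,finite} vec set" and \<alpha> :: "'k::{field,finite}"
  assumes "finite SA" "finite SB" and HC: "HC \<in> carrier_mat u CARD('k)"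
  shows "encode1 \<alpha> \<phi> H HC SA + encode1 \<alpha> \<phi> H HC SB =
    HC *\<^sub>v vec CARD('k) (\<lambda>j. of_nat (card (syndrome_class \<alpha> \<phi> H (sym_diff SA SB) (j + 1))))"
proof -
  let ?z = "\<lambda>S. vec CARD('k) (\<lambda>j. of_nat (card (syndrome_class \<alpha> \<phi> H S (j + 1))) :: bit)"
  have mod2: "of_nat (c mod 2) = (of_nat c :: bit)" for c
  proof -
    have "of_nat (2 * (c div 2) + c mod 2) = (of_nat (c mod 2) :: bit)"
      unfolding of_nat_add of_nat_mult by simp
    then show ?thesis by simp
  qed
  have enc: "encode1 \<alpha> \<phi> H HC S = HC *\<^sub>v ?z S" for S
    unfolding encode1_def syndrome_counts_def
    by (intro arg_cong[where f="\<lambda>v. HC *\<^sub>v v"] eq_vecI) (auto simp: mod2)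
  have "?z SA + ?z SB = ?z (sym_diff SA SB)"
  proof (intro eq_vecI)
    fix j assume "j < dim_vec (?z (sym_diff SA SB))"
    moreover have "syndrome_class \<alpha> \<phi> H (sym_diff SA SB) i =
        sym_diff (syndrome_class \<alpha> \<phi> H SA i) (syndrome_class \<alpha> \<phi> H SB i)" for i
      by (auto simp: syndrome_class_def)
    moreover have "finite (syndrome_class \<alpha> \<phi> H SA i)" "finite (syndrome_class \<alpha> \<phi> H SB i)" for i
      using assms by (auto simp: syndrome_class_def)
    moreover have "of_nat (card X) + of_nat (card Y) = (of_nat (card (sym_diff X Y)) :: bit)"
      if "finite X" "finite Y" for X Y :: "'f vec set"
      using sum_add_sum_eq_sum_sym_diff[OF that, of "\<lambda>_. 1 :: bit"]
      unfolding sum_constant mult_1_right by simp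
    ultimately show "(?z SA + ?z SB) $ j = ?z (sym_diff SA SB) $ j"
      by (simp only: index_add_vec index_vec dim_vec)
  qed simp
  then show ?thesis
    using mult_add_distrib_mat_vec[OF HC, of "?z SA" "?z SB"] by (simp add: enc)
qed

theorem theorem4:
  fixes q n r u m h l :: nat
    and \<alpha> :: "'k::{field,finite}"
    and \<iota>r :: "'f::{field,finite} \<Rightarrow> 'k" and \<phi> :: "'f vec \<Rightarrow> 'k"
    and \<iota>s :: "'f \<Rightarrow> 'l::{field,finite}" and \<psi> :: "'f vec \<Rightarrow> 'l"
    and Hl Hbar :: "'f mat" and Cl :: "'f vec set" and Dl :: "'f vec \<Rightarrow> 'f vec"
    and HC :: "bit mat" and CC :: "bit vec set" and DC :: "bit vec \<Rightarrow> bit vec"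
    and b :: "nat \<Rightarrow> 'l"
    and enum :: "nat set \<Rightarrow> nat list"
    and SA SB :: "'f vec set"
  assumes q_power_of_2: "\<exists>t\<ge>1. q = 2 ^ t"
    and card_f: "CARD('f) = q"
    and card_k: "CARD('k) = q ^ r"
    and card_l: "CARD('l) = q ^ (n - r)"
    and dims: "0 < r" "r < n" "n - r > r"
    and alpha: "primitive_element \<alpha>"
    and ident_r: "linear_identification r \<iota>r \<phi>"
    and ident_s: "linear_identification (n - r) \<iota>s \<psi>"
    and code_l: "linear_code n (2 * l + 1) Cl"
    and parity_l: "parity_check_matrix r n Hl Cl"
    and decoder_l: "syndrome_decoder r n l Hl Dl"
    and code_C: "linear_code (q ^ r) (2 * h + 1) CC"
    and parity_C: "parity_check_matrix u (q ^ r) HC CC"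
    and decoder_C: "syndrome_decoder u (q ^ r) h HC DC"
    and Hbar: "Hbar \<in> carrier_mat (n - r) n"
    and full_rank: "vec_space.rank n (Hl @\<^sub>r Hbar) = n"
    and b_seq: "B_sequence h m b" "m \<ge> q ^ r"
    and enum: "\<And>K. finite K \<Longrightarrow> distinct (enum K) \<and> set (enum K) = K"
    and SA: "SA \<subseteq> carrier_vec n"
    and SB: "SB \<subseteq> carrier_vec n"
    and sets: "one_h_l_sets h l SA SB"
  shows "decode n r \<alpha> \<phi> \<psi> Hl Hbar b Dl DC enum
           (encode1 \<alpha> \<phi> Hl HC SA, encode2 \<alpha> \<phi> \<psi> Hl Hbar b SA)
           (encode1 \<alpha> \<phi> Hl HC SB, encode2 \<alpha> \<phi> \<psi> Hl Hbar b SB)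
         = sym_diff SA SB"
proof -

  \<comment> \<open>Syndrome positions of the symmetric difference\<close>
  define D where "D = sym_diff SA SB"
  define syn where "syn x = alog \<alpha> (\<phi> (Hl *\<^sub>v x))" for x
  define K where "K = syn ` D"
  \<comment> \<open>Once \<open>syn\<close> is shown injective on \<open>D\<close>,
    \<open>X k\<close> is the one word of \<open>D\<close> at position \<open>k\<close>.\<close>
  define X where "X = inv_into D syn"
  let ?N = "CARD('k)"
  obtain t where q: "q = 2 ^ t" using q_power_of_2 by blast
  have char_f: "x + x = 0" for x :: 'f
    using add_self_eq_0_if_card_power_of_2[of t x] card_f q by simp
  have char_l: "x + x = 0" for x :: 'l
    using add_self_eq_0_if_card_power_of_2[of "t * (n - r)" x] card_l q by (simp add: power_mult)
  have Hl: "Hl \<in> carrier_mat r n" and HC: "HC \<in> carrier_mat u ?N"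
    using parity_l parity_C card_k by (auto simp: parity_check_matrix_def)
  have fin: "finite SA" "finite SB" "finite D"
    using SA SB finite_carrier_vec finite_subset unfolding D_def by blast+
  have Dn: "x \<in> carrier_vec n" if "x \<in> D" for x
    using that SA SB by (auto simp: D_def)
  have card_D: "card D \<le> h" and dist_D: "\<And>x y. x \<in> D \<Longrightarrow> y \<in> D \<Longrightarrow> hamming_dist x y \<le> l"
    using sets by (auto simp: one_h_l_sets_def D_def)
  have \<phi>: "bij_betw \<phi> (carrier_vec r) UNIV"
    "\<And>x y. x \<in> carrier_vec r \<Longrightarrow> y \<in> carrier_vec r \<Longrightarrow> \<phi> (x + y) = \<phi> x + \<phi> y"
    using ident_r by (auto simp: linear_identification_def)
  have \<psi>: "bij_betw \<psi> (carrier_vec (n - r)) UNIV"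
    "\<And>x y. x \<in> carrier_vec (n - r) \<Longrightarrow> y \<in> carrier_vec (n - r) \<Longrightarrow> \<psi> (x + y) = \<psi> x + \<psi> y"
    using ident_s by (auto simp: linear_identification_def)
  have vec_of_\<phi>: "vec_of r \<phi> (\<phi> x) = x" if "x \<in> carrier_vec r" for x
    using \<phi>(1) that by (simp add: bij_betw_def)
  have vec_of_\<psi>: "vec_of (n - r) \<psi> (\<psi> x) = x" if "x \<in> carrier_vec (n - r)" for x
    using \<psi>(1) that by (simp add: bij_betw_def)
  have Hl_vec: "Hl *\<^sub>v x \<in> carrier_vec r" and Hbar_vec: "Hbar *\<^sub>v x \<in> carrier_vec (n - r)" for x
    by (rule carrier_vecI, simp only: dim_mult_mat_vec carrier_matD[OF Hl] carrier_matD[OF Hbar])+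
  have apow_syn: "apow \<alpha> (syn x) = \<phi> (Hl *\<^sub>v x)" for x
    unfolding syn_def by (rule apow_alog[OF alpha])
  have syn_range: "syn x \<in> {1..?N}" for x
    unfolding syn_def by (rule alog_in_range[OF alpha])

  \<comment> \<open>In characteristic 2 the sum is the difference, of weight at most
    \<open>l\<close>. The case \<open>x = y\<close> is included on purpose.\<close>
  have decode_add: "Dl (Hl *\<^sub>v x + Hl *\<^sub>v y) = x + y" if "x \<in> D" "y \<in> D" for x y
  proof -
    have "x + y = x - y"
      using add_eq_diff_vec[OF Dn Dn char_f] that by blast
    then have "hamming_weight (x + y) \<le> l"
      using hamming_weight_diff[OF Dn Dn] dist_D that by simp
    moreover have "x + y \<in> carrier_vec n" using Dn that by simp
    ultimately have "Dl (Hl *\<^sub>v (x + y)) = x + y"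
      using decoder_l by (simp add: syndrome_decoder_def)
    then show ?thesis
      using mult_add_distrib_mat_vec[OF Hl Dn Dn] that by simp
  qed
  have cancel: "x + (x + y) = y" if "x \<in> carrier_vec n" "y \<in> carrier_vec n" for x y :: "'f vec"
  proof -
    have "a + (a + c) = c" for a c :: 'f
      using char_f[of a] by (simp flip: add.assoc)
    with that show ?thesis by (intro eq_vecI) auto
  qed
  \<comment> \<open>With equal syndromes the decoder gets the same input for the pairs
    \<open>x, x\<close> and \<open>x, y\<close>, so \<open>x + x = x + y\<close>.\<close>
  have inj: "inj_on syn D"
  proof (rule inj_onI)
    fix x y assume xy: "x \<in> D" "y \<in> D" "syn x = syn y"
    then have "\<phi> (Hl *\<^sub>v x) = \<phi> (Hl *\<^sub>v y)" by (metis apow_syn)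
    then have "Hl *\<^sub>v x = Hl *\<^sub>v y" using vec_of_\<phi> Hl_vec by metis
    then have "x + x = x + y" using decode_add xy by metis
    then show "x = y" using cancel Dn xy by metis
  qed
  have X: "X k \<in> D" "syn (X k) = k" if "k \<in> K" for k
    using that by (auto simp: X_def K_def inv_into_into f_inv_into_f)
  have XK: "X ` K = D"
    using inj by (auto simp: X_def K_def)
  have K: "finite K" "K \<subseteq> {1..?N}" "card K \<le> h"
    using fin syn_range card_D card_image_le[of D syn] by (auto simp: K_def)

  \<comment> \<open>Recovering the positions from the first component\<close>
  define z where "z = vec ?N (\<lambda>j. if j + 1 \<in> K then 1 else 0 :: bit)"
  \<comment> \<open>By injectivity of \<open>syn\<close> a class contains at most one word, so its
    parity tells whether it is inhabited.\<close>
  have class_card: "of_nat (card (syndrome_class \<alpha> \<phi> Hl D i)) = (if i \<in> K then 1 else 0 :: bit)"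
    if "i \<in> {1..?N}" for i
  proof -
    have "syndrome_class \<alpha> \<phi> Hl D i = {x \<in> D. syn x = i}"
      unfolding syndrome_class_def using alog_apow[OF alpha that] apow_syn syn_def by auto
    also have "\<dots> = (if i \<in> K then {X i} else {})"
      using X inj by (auto simp: K_def inj_on_def)
    finally show ?thesis by simp
  qed
  have "encode1 \<alpha> \<phi> Hl HC SA + encode1 \<alpha> \<phi> Hl HC SB = HC *\<^sub>v z"
    unfolding encode1_add[OF fin(1,2) HC] z_def D_def[symmetric]
    by (intro arg_cong[where f="\<lambda>v. HC *\<^sub>v v"] eq_vecI) (auto simp: class_card)
  \<comment> \<open>\<open>Suc\<close> maps the support of \<open>z\<close>, indexed from 0,
    injectively into \<open>K\<close>.\<close>
  moreover have "hamming_weight z \<le> h"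
  proof -
    have "card {j. j < ?N \<and> Suc j \<in> K} \<le> card K"
      using K(1) by (intro card_inj_on_le[where f=Suc]) auto
    moreover have "{j. j < dim_vec z \<and> z $ j \<noteq> 0} = {j. j < ?N \<and> Suc j \<in> K}"
      by (auto simp: z_def split: if_splits)
    ultimately show ?thesis using K(3) by (simp add: hamming_weight_def)
  qed
  moreover have "z \<in> carrier_vec (q ^ r)" unfolding z_def card_k by (rule vec_carrier)
  ultimately have zhat: "DC (encode1 \<alpha> \<phi> Hl HC SA + encode1 \<alpha> \<phi> Hl HC SB) = z"
    using decoder_C unfolding syndrome_decoder_def by metis
  have pos: "{i\<in>{1..?N}. z $ (i - 1) = 1} = K"
  proof -
    have "z $ (i - 1) = 1 \<longleftrightarrow> i \<in> K" if "i \<in> {1..?N}" for i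
      using that by (auto simp: z_def split: if_splits)
    then show ?thesis using K(2) by blast
  qed

  \<comment> \<open>The second component as a sum over positions\<close>
  have enc2: "encode2 \<alpha> \<phi> \<psi> Hl Hbar b SA + encode2 \<alpha> \<phi> \<psi> Hl Hbar b SB =
      (\<Sum>k\<in>K. b k * \<psi> (Hbar *\<^sub>v X k))"
  proof -
    have "encode2 \<alpha> \<phi> \<psi> Hl Hbar b SA + encode2 \<alpha> \<phi> \<psi> Hl Hbar b SB =
        (\<Sum>x\<in>D. b (syn x) * \<psi> (Hbar *\<^sub>v x))"
      unfolding encode2_def D_def syn_def
      using sum_add_sum_eq_sum_sym_diff[OF fin(1,2),
          of "\<lambda>x. b (alog \<alpha> (\<phi> (Hl *\<^sub>v x))) * \<psi> (Hbar *\<^sub>v x)", OF char_l] .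
    also have "\<dots> = (\<Sum>k\<in>K. b k * \<psi> (Hbar *\<^sub>v X k))"
      unfolding K_def using inj by (simp add: sum.reindex X_def)
    finally show ?thesis .
  qed

  \<comment> \<open>Recovering the words\<close>
  show ?thesis
  proof (cases "D = {}")
    case True
    then have "z = 0\<^sub>v ?N" by (auto simp: z_def K_def)
    then show ?thesis
      using True by (simp add: decode_def zhat D_def Let_def)
  next
    case False
    then have K_ne: "K \<noteq> {}" by (simp add: K_def)
    have z_ne: "z \<noteq> 0\<^sub>v ?N"
    proof
      assume "z = 0\<^sub>v ?N"
      then have "z $ (i - 1) \<noteq> 1" if "i \<in> {1..?N}" for i using that by auto
      then show False using pos K_ne by blast
    qed
    obtain k1 ks where ks: "enum K = k1 # ks"
      using enum[OF K(1)] K_ne by (cases "enum K") auto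
    then have dks: "distinct (k1 # ks)" and sks: "insert k1 (set ks) = K"
      using enum[OF K(1)] by auto
    \<comment> \<open>The head of the list, in whatever order \<open>enum\<close> chose, fixes the
      reference word that all differences are taken from.\<close>
    define x1 where "x1 = X k1"
    have x1: "x1 \<in> D" "syn x1 = k1" using X sks by (auto simp: x1_def)
    \<comment> \<open>Additivity of \<phi> identifies the decoder's argument as the sum of the two
      syndromes.\<close>
    have ehat: "Dl (vec_of r \<phi> (apow \<alpha> k1 + apow \<alpha> k)) = x1 + X k" if "k \<in> set ks" for k
    proof -
      have k: "X k \<in> D" "syn (X k) = k" using X that sks by auto
      have "apow \<alpha> k1 + apow \<alpha> k = \<phi> (Hl *\<^sub>v x1 + Hl *\<^sub>v X k)"
        using apow_syn[of x1] apow_syn[of "X k"] x1 k \<phi>(2)[OF Hl_vec Hl_vec] by simp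
      then show ?thesis
        using vec_of_\<phi>[of "Hl *\<^sub>v x1 + Hl *\<^sub>v X k"] Hl_vec decode_add x1 k by simp
    qed
    have "(\<Sum>k\<leftarrow>ks. b k * \<psi> (Hbar *\<^sub>v Dl (vec_of r \<phi> (apow \<alpha> k1 + apow \<alpha> k)))) =
        (\<Sum>k\<in>set ks. b k * \<psi> (Hbar *\<^sub>v x1) + b k * \<psi> (Hbar *\<^sub>v X k))"
    proof -
      have "\<psi> (Hbar *\<^sub>v (x1 + X k)) = \<psi> (Hbar *\<^sub>v x1) + \<psi> (Hbar *\<^sub>v X k)" if "k \<in> set ks" for k
        using X[of k] x1 that sks Dn \<psi>(2)[OF Hbar_vec Hbar_vec]
          mult_add_distrib_mat_vec[OF Hbar, of x1 "X k"] by auto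
      then show ?thesis
        using dks by (auto simp: sum_list_distinct_conv_sum_set ehat distrib_left intro!: sum.cong)
    qed
    \<comment> \<open>Each correction term splits in two: the halves with \<open>X k\<close> cancel
      against the second component, those with \<open>x1\<close> remain. The term for
      \<open>k1\<close> needs no correction, since \<open>X k1 = x1\<close>.\<close>
    then have z': "(\<Sum>k\<in>K. b k * \<psi> (Hbar *\<^sub>v X k)) +
        (\<Sum>k\<leftarrow>ks. b k * \<psi> (Hbar *\<^sub>v Dl (vec_of r \<phi> (apow \<alpha> k1 + apow \<alpha> k)))) =
        (\<Sum>k\<in>K. b k) * \<psi> (Hbar *\<^sub>v x1)"
      using dks char_l[of "\<Sum>k\<in>set ks. b k * \<psi> (Hbar *\<^sub>v X k)"]
      by (simp add: x1_def sum.distrib sum_distrib_right algebra_simps flip: sks)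
    have "K \<subseteq> {1..m}" using K(2) b_seq(2) card_k by fastforce
    then have "(\<Sum>k\<in>K. b k) \<noteq> 0"
      using B_sequence_sum_nonzero[OF b_seq(1) _ K_ne K(3)] by blast
    then have s2: "(\<Sum>k\<in>K. b k) * \<psi> (Hbar *\<^sub>v x1) / (\<Sum>k\<in>K. b k) = \<psi> (Hbar *\<^sub>v x1)"
      by (rule nonzero_mult_div_cancel_left)
    have sum_ks: "(\<Sum>k\<leftarrow>k1 # ks. b k) = (\<Sum>k\<in>K. b k)"
      unfolding sum_list_distinct_conv_sum_set[OF dks] using sks by simp
    \<comment> \<open>The stacked vector is the full-rank matrix applied to \<open>x1\<close>, which
      the inverse undoes.\<close>
    have "Hl @\<^sub>r Hbar \<in> carrier_mat n n"
      using carrier_append_rows[OF Hl Hbar] dims by simp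
    then have xhat: "the (mat_inverse (Hl @\<^sub>r Hbar)) *\<^sub>v (Hl *\<^sub>v x1 @\<^sub>v Hbar *\<^sub>v x1) = x1"
      using mat_inverse_mult_vec[OF _ full_rank, of x1] mat_mult_append[OF Hl Hbar] Dn x1 by simp
    \<comment> \<open>Adding \<open>x1\<close> to the recovered \<open>x1 + X k\<close> leaves
      \<open>X k\<close>, so the output is the image of \<open>K\<close> under
      \<open>X\<close>.\<close>
    have "insert x1 ((\<lambda>k. x1 + Dl (vec_of r \<phi> (apow \<alpha> k1 + apow \<alpha> k))) ` set ks) = D"
    proof -
      have "x1 + Dl (vec_of r \<phi> (apow \<alpha> k1 + apow \<alpha> k)) = X k" if "k \<in> set ks" for k
        using ehat[OF that] cancel Dn x1 X sks that by auto
      then have "(\<lambda>k. x1 + Dl (vec_of r \<phi> (apow \<alpha> k1 + apow \<alpha> k))) ` set ks = X ` set ks"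
        by (rule image_cong[OF refl])
      then show ?thesis using XK sks x1_def by auto
    qed
    moreover have "apow \<alpha> k1 = \<phi> (Hl *\<^sub>v x1)" using apow_syn[of x1] x1 by simp
    ultimately show ?thesis
      unfolding decode_def fst_conv snd_conv zhat pos Let_def if_not_P[OF z_ne] ks list.sel enc2
        z' sum_ks s2 vec_of_\<psi>[OF Hbar_vec] D_def[symmetric]
      by (simp add: vec_of_\<phi>[OF Hl_vec] xhat)
  qed
qed

end
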